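(* Let $\{\pi_n\}_{n\ge 0}$ be the polynomials determined by $\pi_0(x)=1$, $\pi_1(x)=x$ and $\pi_{n+1}(x)=(x-n^2)\pi_n(x)-\frac14\pi_{n-1}(x)$ for $n\ge 1$. Then, as $n\to\infty$, $$\pi_n(n^2y)\sim\left(\frac{n}{e}\right)^{2n}\exp\left\{n\left[(\sqrt y+1)\log(\sqrt y+1)-(\sqrt y-1)\log(\sqrt y-1)\right]\right\}\left(\frac{y}{y-1}\right)^{1/2}$$ for complex $y$ bounded away from $[0,1]$; that is, for every $\eta>0$ the ratio of the two sides tends to $1$ as $n\to\infty$, uniformly for $y\in\mathbb{C}$ with $\mathrm{dist}(y,[0,1])\ge\eta$.
   Context: All square roots and logarithms take their principal values. (For integer $n$, the exponential factor is then continuous across the negative real axis in $y$, and it equals $\exp\{n[2+\int_0^1\log(y-t^2)\,dt]\}$; the factor $(y/(y-1))^{1/2}$ is analytic in $\mathbb{C}\setminus[0,1]$ and tends to $1$ as $y\to\infty$.) *)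

theory Defs
  imports
    "HOL-Complex_Analysis.Complex_Analysis"
    "HOL-Computational_Algebra.Polynomial"
begin

fun pi_poly :: "nat \<Rightarrow> complex poly" where
  "pi_poly 0 = 1"
| "pi_poly (Suc 0) = [:0, 1:]"
| "pi_poly (Suc (Suc m)) =
     [:- (of_nat (Suc m))\<^sup>2, 1:] * pi_poly (Suc m) - smult (1 / 4) (pi_poly m)"

text \<open>\<^const>\<open>csqrt\<close> and \<^const>\<open>Ln\<close> are the principal branches,
  with the argument in \<open>(-\<pi>, \<pi>]\<close>.\<close>

definition pi_asymp :: "nat \<Rightarrow> complex \<Rightarrow> complex" where
  "pi_asymp n y =
     (of_nat n / exp 1) ^ (2 * n) *
     exp (of_nat n * ((csqrt y + 1) * Ln (csqrt y + 1) - (csqrt y - 1) * Ln (csqrt y - 1))) *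
     csqrt (y / (y - 1))"

end

theory Submission
  imports Defs
begin

text \<open>
  Put \<open>x = n\<^sup>2 y\<close>. Each coefficient \<open>x - k\<^sup>2 = n\<^sup>2 (y - (k/n)\<^sup>2)\<close> with \<open>k < n\<close> has modulus at
  least \<open>n\<^sup>2 \<eta>\<close>, because \<open>(k/n)\<^sup>2\<close> lies in \<open>[0, 1]\<close>. Beside coefficients of this size the term
  \<open>\<pi>\<^sub>m\<^sub>-\<^sub>1 / 4\<close> is a small perturbation: dividing \<open>\<pi>\<^sub>m\<close> by the solution \<open>\<Prod>k<m. x - k\<^sup>2\<close> of the
  recurrence without that term leaves a ratio that changes by a relative amount of order
  \<open>n\<^sup>-\<^sup>4\<close> at each of the \<open>n\<close> steps, hence tends to \<open>1\<close> (\<open>pi_poly_near_product\<close>).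

  The product itself is \<open>n\<^sup>2\<^sup>n exp (\<Sum>k<n. g (k/n))\<close>, where, with \<open>s = csqrt y\<close>,
  \<open>g t = Ln (s + t) + Ln (s - t)\<close> is a logarithm of \<open>y - t\<^sup>2\<close> that is analytic near \<open>[0, 1]\<close>.
  The trapezoidal rule gives \<open>n \<integral> g + (g 0 - g 1) / 2 + O(1/n)\<close> for the sum, with an implied
  constant that depends only on a bound for \<open>g''\<close>
  (\<open>riemann_sum_with_boundary_term\<close>), and such a bound holds uniformly in \<open>y\<close>, also for large
  \<open>y\<close>, since \<open>s + t\<close> and \<open>s - t\<close> stay away from \<open>0\<close> (\<open>csqrt_shift_norm_ge\<close>). The explicit
  antiderivative of \<open>g\<close> produces the exponential factor of the asymptotic form and the power of
  \<open>n / e\<close>; the boundary term produces \<open>(y / (y - 1))\<^sup>1\<^sup>/\<^sup>2\<close>. That it is the principal square root is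
  a question of branches, settled by comparing the arguments of \<open>s - 1\<close>, \<open>s\<close> and \<open>s + 1\<close>
  (\<open>csqrt_eq_exp_boundary_term\<close>).
\<close>

section \<open>The trapezoidal rule along a segment\<close>

text \<open>
  The error \<open>E\<close>, as a function of the endpoint \<open>z\<close>, vanishes at \<open>a\<close> together with its derivative,
  and its second derivative is \<open>- (z - a) * g'' z / 2\<close>. Two applications of the mean value bound
  give the cubic estimate.
\<close>

lemma trapezoid_step:
  fixes G g g' g'' :: "complex \<Rightarrow> complex"
  assumes G: "\<And>z. z \<in> closed_segment a b \<Longrightarrow> (G has_field_derivative g z) (at z)"
    and g: "\<And>z. z \<in> closed_segment a b \<Longrightarrow> (g has_field_derivative g' z) (at z)"
    and g': "\<And>z. z \<in> closed_segment a b \<Longrightarrow> (g' has_field_derivative g'' z) (at z)"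
    and M: "\<And>z. z \<in> closed_segment a b \<Longrightarrow> norm (g'' z) \<le> M"
  shows "norm (G b - G a - (b - a) / 2 * (g a + g b)) \<le> M * norm (b - a) ^ 3 / 2"
proof -
  define E where "E z = G z - G a - (z - a) / 2 * (g a + g z)" for z
  define E1 where "E1 z = (g z - g a - (z - a) * g' z) / 2" for z
  let ?S = "closed_segment a b"
  have dE: "(E has_field_derivative E1 z) (at z within ?S)" if "z \<in> ?S" for z
    using G[OF that, THEN has_field_derivative_at_within] g[OF that, THEN has_field_derivative_at_within]
    unfolding E_def E1_def by (auto intro!: derivative_eq_intros simp: field_simps)
  have dE1: "(E1 has_field_derivative - (z - a) * g'' z / 2) (at z within ?S)" if "z \<in> ?S" for z
    using g[OF that, THEN has_field_derivative_at_within] g'[OF that, THEN has_field_derivative_at_within]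
    unfolding E1_def by (auto intro!: derivative_eq_intros simp: field_simps)
  have near: "norm (z - a) \<le> norm (b - a)" if "z \<in> ?S" for z
    using segment_bound[OF that] by simp
  have M0: "0 \<le> M" using M[of a] norm_ge_zero[of "g'' a"] by (simp del: norm_ge_zero)
  have "norm (E1 z) \<le> norm (b - a) * M / 2 * norm (b - a)" if z: "z \<in> ?S" for z
  proof -
    have "norm (E1 z - E1 a) \<le> norm (b - a) * M / 2 * norm (z - a)"
    proof (rule field_differentiable_bound[OF convex_closed_segment dE1])
      fix w assume w: "w \<in> ?S"
      have "norm (w - a) * norm (g'' w) \<le> norm (b - a) * M"
        by (intro mult_mono near M w) auto
      then show "norm (- (w - a) * g'' w / 2) \<le> norm (b - a) * M / 2"
        by (simp add: norm_mult norm_divide norm_minus_commute)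
    qed (use z in auto)
    also have "\<dots> \<le> norm (b - a) * M / 2 * norm (b - a)"
      using M0 by (intro mult_left_mono near z) auto
    finally show ?thesis by (simp add: E1_def)
  qed
  from field_differentiable_bound[OF convex_closed_segment dE this, of b a]
  have "norm (E b - E a) \<le> norm (b - a) * M / 2 * norm (b - a) * norm (b - a)" by auto
  then show ?thesis by (simp add: E_def power3_eq_cube mult_ac)
qed

text \<open>
  Summing the trapezoidal rule over \<open>n\<close> steps of length \<open>1/n\<close>: the error per step is of order
  \<open>n\<^sup>-\<^sup>3\<close>, and scaling the integral by \<open>n\<close> leaves a total error of order \<open>1/n\<close>. The integral
  appears as an increment of the antiderivative \<open>G\<close>, so that the closed form can be substituted
  for it directly.
\<close>

lemma riemann_sum_with_boundary_term:
  fixes G g g' g'' :: "complex \<Rightarrow> complex" and n :: nat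
  assumes G: "\<And>z. z \<in> closed_segment 0 1 \<Longrightarrow> (G has_field_derivative g z) (at z)"
    and g: "\<And>z. z \<in> closed_segment 0 1 \<Longrightarrow> (g has_field_derivative g' z) (at z)"
    and g': "\<And>z. z \<in> closed_segment 0 1 \<Longrightarrow> (g' has_field_derivative g'' z) (at z)"
    and M: "\<And>z. z \<in> closed_segment 0 1 \<Longrightarrow> norm (g'' z) \<le> M"
    and n: "n > 0"
  shows "norm ((\<Sum>k<n. g (of_nat k / of_nat n)) - (of_nat n * (G 1 - G 0) + (g 0 - g 1) / 2))
           \<le> M / (2 * n)"
proof -
  define p :: "nat \<Rightarrow> complex" where "p k = of_nat k / of_nat n" for k
  define T where "T k = G (p (Suc k)) - G (p k) - (p (Suc k) - p k) / 2 * (g (p k) + g (p (Suc k)))" for k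
  have p0: "p 0 = 0" and pn: "p n = 1" using n by (simp_all add: p_def)
  have step: "p (Suc k) - p k = 1 / of_nat n" for k
    by (simp add: p_def diff_divide_distrib[symmetric])
  have mem: "p k \<in> closed_segment 0 1" if "k \<le> n" for k
    unfolding closed_segment_def p_def using that n
    by (auto intro!: exI[of _ "real k / real n"] simp: scaleR_conv_of_real)
  have T: "norm (T k) \<le> M * (1 / n) ^ 3 / 2" if "k < n" for k
  proof -
    have sub: "closed_segment (p k) (p (Suc k)) \<subseteq> closed_segment 0 1"
      using mem[of k] mem[of "Suc k"] that by (intro closed_segment_subset) auto
    have "norm (T k) \<le> M * norm (p (Suc k) - p k) ^ 3 / 2"
      unfolding T_def by (rule trapezoid_step) (use sub G g g' M in blast)+
    then show ?thesis by (simp add: step norm_divide)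
  qed
  define dG where "dG k = G (p (Suc k)) - G (p k)" for k
  define dg where "dg k = g (p (Suc k)) - g (p k)" for k
  have sums: "(\<Sum>k<n. dG k) = G 1 - G 0" "(\<Sum>k<n. dg k) = g 1 - g 0"
    unfolding dG_def dg_def by (subst sum_lessThan_telescope; simp add: p0 pn)+
  have "of_nat n * T k = of_nat n * dG k - g (p k) - dg k / 2" for k
    using n unfolding T_def step dG_def dg_def by (simp add: field_simps)
  then have nT: "of_nat n * (\<Sum>k<n. T k) = of_nat n * (\<Sum>k<n. dG k) - (\<Sum>k<n. g (p k)) - (\<Sum>k<n. dg k) / 2"
    by (simp only: sum_distrib_left sum_subtractf sum_divide_distrib)
  have "(\<Sum>k<n. g (p k)) - (of_nat n * (G 1 - G 0) + (g 0 - g 1) / 2)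
      = - (of_nat n * (\<Sum>k<n. T k))"
    unfolding nT sums by (simp add: field_simps)
  also have "norm \<dots> \<le> n * (\<Sum>k<n. M * (1 / n) ^ 3 / 2)"
    unfolding norm_minus_cancel norm_mult norm_of_nat
    by (intro mult_left_mono sum_norm_le) (use T in auto)
  also have "\<dots> = M / (2 * n)"
    using n by (simp add: field_simps power3_eq_cube)
  finally show ?thesis by (simp add: p_def)
qed

section \<open>The linear factors of \<open>y - t\<^sup>2\<close>\<close>

text \<open>
  The principal root \<open>s\<close> has nonnegative real part, so for \<open>0 \<le> t \<le> 1\<close> a nonpositive real value
  of \<open>s + t\<close> or \<open>s - t\<close> would force \<open>s \<in> [0, 1]\<close>, and then \<open>y = s\<^sup>2 \<in> [0, 1]\<close>. This keeps every
  logarithm below away from its branch cut.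
\<close>

lemma csqrt_shift_not_nonpos_Reals:
  assumes y: "y \<notin> closed_segment (0::complex) 1" and z: "z \<in> closed_segment 0 1"
  shows "csqrt y + z \<notin> \<real>\<^sub>\<le>\<^sub>0" "csqrt y - z \<notin> \<real>\<^sub>\<le>\<^sub>0"
proof -
  obtain t where t: "0 \<le> t" "t \<le> 1" "z = of_real t"
    using z by (auto simp: closed_segment_def scaleR_conv_of_real)
  define s where "s = csqrt y"
  have y_eq: "y = s\<^sup>2" by (simp add: s_def)
  have not01: False if "s = of_real r" "0 \<le> r" "r \<le> 1" for r
  proof -
    have "y = of_real (r\<^sup>2)" using that by (simp add: y_eq)
    moreover have "0 \<le> r\<^sup>2" "r\<^sup>2 \<le> 1" using that by (auto simp: power_le_one)
    ultimately have "y \<in> closed_segment 0 1"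
      by (auto simp: closed_segment_def scaleR_conv_of_real intro!: exI[of _ "r\<^sup>2"])
    with y show False by simp
  qed
  have re: "0 \<le> Re s" using csqrt_principal[of y] by (auto simp: s_def)
  have real: "s = of_real (Re s)" if "Im s = 0" using that by (simp add: complex_eq_iff)
  show "csqrt y + z \<notin> \<real>\<^sub>\<le>\<^sub>0"
    using not01[OF real] re t by (auto simp: complex_nonpos_Reals_iff s_def[symmetric])
  show "csqrt y - z \<notin> \<real>\<^sub>\<le>\<^sub>0"
    using not01[OF real] re t by (auto simp: complex_nonpos_Reals_iff s_def[symmetric])
qed

text \<open>
  For \<open>\<bar>s\<bar> \<ge> 2\<close> the bound \<open>1\<close> is the triangle inequality. For \<open>\<bar>s\<bar> < 2\<close> the product of the two
  factors is \<open>y - t\<^sup>2\<close>, of modulus at least \<open>\<eta>\<close>, while \<open>\<bar>s + t\<bar> \<le> 3\<close>. The other factor is the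
  larger one, as \<open>Re s \<ge> 0\<close>. Having a bound that holds for arbitrarily large \<open>y\<close> is what makes
  the final estimate uniform on an unbounded set.
\<close>

lemma csqrt_shift_norm_ge:
  assumes y: "\<And>t. t \<in> {0..1} \<Longrightarrow> norm (y - of_real t) \<ge> \<eta>"
    and z: "z \<in> closed_segment 0 1"
  shows "norm (csqrt y + z) \<ge> min 1 (\<eta> / 3)" "norm (csqrt y - z) \<ge> min 1 (\<eta> / 3)"
proof -
  obtain t where t: "0 \<le> t" "t \<le> 1" "z = of_real t"
    using z by (auto simp: closed_segment_def scaleR_conv_of_real)
  define s where "s = csqrt y"
  have re: "0 \<le> Re s" using csqrt_principal[of y] by (auto simp: s_def)
  have "(Re s - t)\<^sup>2 \<le> (Re s + t)\<^sup>2"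
    using t re by (simp add: power2_eq_square algebra_simps)
  then have le: "norm (s - z) \<le> norm (s + z)"
    by (simp add: t cmod_def)
  have "\<eta> \<le> norm (y - of_real (t\<^sup>2))"
    using t by (intro y) (auto simp: power_le_one)
  also have "y - of_real (t\<^sup>2) = (s - z) * (s + z)"
    by (simp add: s_def t algebra_simps flip: power2_eq_square)
  finally have prod: "\<eta> \<le> norm (s - z) * norm (s + z)" by (simp add: norm_mult)
  have nz: "norm z \<le> 1" using t by simp
  have "norm (s - z) \<ge> min 1 (\<eta> / 3)"
  proof (cases "norm s \<ge> 2")
    case True
    then show ?thesis using nz norm_triangle_ineq2[of s z] by simp
  next
    case False
    then have "norm (s + z) \<le> 3" using nz norm_triangle_ineq[of s z] by simp
    then have "norm (s - z) * norm (s + z) \<le> norm (s - z) * 3"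
      by (intro mult_left_mono) auto
    with prod show ?thesis by linarith
  qed
  with le show "norm (csqrt y + z) \<ge> min 1 (\<eta> / 3)" "norm (csqrt y - z) \<ge> min 1 (\<eta> / 3)"
    by (auto simp: s_def)
qed

text \<open>
  The sign of \<open>Im (u * cnj v)\<close> is that of the sine of the difference of the arguments, which
  identifies the sign of that difference as long as it exceeds \<open>- \<pi>\<close>.
\<close>

lemma Im_Ln_less_if_Im_mult_cnj_pos:
  assumes nz: "u \<noteq> 0" "v \<noteq> 0"
    and pos: "0 < Im (u * cnj v)" and gt: "- pi < Im (Ln u) - Im (Ln v)"
  shows "Im (Ln v) < Im (Ln u)"
proof -
  define x where "x = Im (Ln u) - Im (Ln v)"
  have "Im (u * cnj v) = Im (exp (Ln u) * cnj (exp (Ln v)))"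
    using nz by simp
  also have "\<dots> = exp (Re (Ln u)) * exp (Re (Ln v)) * sin x"
    by (simp add: x_def Re_exp Im_exp sin_diff algebra_simps)
  finally have "0 < exp (Re (Ln u)) * exp (Re (Ln v)) * sin x" using pos by simp
  then have "0 < sin x" by (rule zero_less_mult_pos) simp
  moreover have "- pi < x" using gt by (simp add: x_def)
  ultimately have "0 < x" using sin_ge_zero[of "- x"] by (cases "x > 0") auto
  then show ?thesis by (simp add: x_def)
qed

text \<open>
  In the upper half plane \<open>arg (s + 1) < arg s < arg (s - 1)\<close>, so the quantity is
  \<open>(arg s - arg (s + 1)) - (arg (s - 1) - arg s)\<close>, a difference of two numbers in \<open>(0, \<pi>)\<close>.
  The lower half plane follows by conjugation, and on the real axis, where \<open>s > 1\<close>, all three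
  arguments vanish.
\<close>

lemma abs_Im_boundary_term_less_pi:
  assumes re: "0 \<le> Re s" and sp: "s + 1 \<notin> \<real>\<^sub>\<le>\<^sub>0" and sm: "s - 1 \<notin> \<real>\<^sub>\<le>\<^sub>0" and s: "s \<notin> \<real>\<^sub>\<le>\<^sub>0"
  shows "\<bar>Im (2 * Ln s - (Ln (s + 1) + Ln (s - 1)))\<bar> < pi"
proof -
  have upper: "\<bar>Im (2 * Ln s - (Ln (s + 1) + Ln (s - 1)))\<bar> < pi"
    if re: "0 \<le> Re s" and im: "0 < Im s" for s
  proof -
    have nz: "s \<noteq> 0" "s + 1 \<noteq> 0" "s - 1 \<noteq> 0" using im by (auto simp: complex_eq_iff)
    have s: "0 < Im (Ln s)" "Im (Ln s) \<le> pi / 2"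
      using Im_Ln_pos_lt[OF nz(1)] Re_Ln_pos_le[OF nz(1)] re im by auto
    have p: "0 < Im (Ln (s + 1))" "Im (Ln (s + 1)) \<le> pi / 2"
      using Im_Ln_pos_lt[OF nz(2)] Re_Ln_pos_le[OF nz(2)] re im by auto
    have m: "0 < Im (Ln (s - 1))" "Im (Ln (s - 1)) < pi"
      using Im_Ln_pos_lt[OF nz(3)] im by auto
    have "Im (Ln (s + 1)) < Im (Ln s)"
      using nz s p im by (intro Im_Ln_less_if_Im_mult_cnj_pos) (auto simp: algebra_simps)
    moreover have "Im (Ln s) < Im (Ln (s - 1))"
      using nz s m im by (intro Im_Ln_less_if_Im_mult_cnj_pos) (auto simp: algebra_simps)
    ultimately show ?thesis using s p m by (simp add: abs_if)
  qed
  consider "0 < Im s" | "Im s < 0" | "Im s = 0" by linarith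
  then show ?thesis
  proof cases
    case 1
    then show ?thesis using upper re by blast
  next
    case 2
    then have "\<bar>Im (2 * Ln (cnj s) - (Ln (cnj s + 1) + Ln (cnj s - 1)))\<bar> < pi"
      using upper[of "cnj s"] re by simp
    moreover have "Ln (cnj s) = cnj (Ln s)" "Ln (cnj s + 1) = cnj (Ln (s + 1))"
      "Ln (cnj s - 1) = cnj (Ln (s - 1))"
      using cnj_Ln[OF s] cnj_Ln[OF sp] cnj_Ln[OF sm] by simp_all
    ultimately show ?thesis by (simp add: abs_if split: if_splits)
  next
    case 3
    then obtain a where a: "s = of_real a" by (metis complex_is_Real_iff Reals_cases)
    have "a > 1" using sm unfolding a by (simp add: complex_nonpos_Reals_iff)
    then show ?thesis
      unfolding a using Ln_of_real[of a] Ln_of_real[of "a + 1"] Ln_of_real[of "a - 1"] by simp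
  qed
qed

text \<open>
  The right-hand side squares to \<open>y / (y - 1)\<close>. The bound on the imaginary part of the exponent
  makes its real part positive, which singles out the principal root.
\<close>

lemma csqrt_eq_exp_boundary_term:
  assumes y: "y \<notin> closed_segment (0::complex) 1"
  shows "csqrt (y / (y - 1)) = exp ((2 * Ln (csqrt y) - (Ln (csqrt y + 1) + Ln (csqrt y - 1))) / 2)"
proof -
  define s where "s = csqrt y"
  have s: "s \<notin> \<real>\<^sub>\<le>\<^sub>0" and sp: "s + 1 \<notin> \<real>\<^sub>\<le>\<^sub>0" and sm: "s - 1 \<notin> \<real>\<^sub>\<le>\<^sub>0"
    using csqrt_shift_not_nonpos_Reals(1)[OF y, of 0] csqrt_shift_not_nonpos_Reals[OF y, of 1] by (auto simp: s_def)
  have nz: "s \<noteq> 0" "s + 1 \<noteq> 0" "s - 1 \<noteq> 0" using s sp sm by auto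
  define d where "d = 2 * Ln s - (Ln (s + 1) + Ln (s - 1))"
  have "\<bar>Im d\<bar> < pi"
    unfolding d_def using s sp sm csqrt_principal[of y] by (intro abs_Im_boundary_term_less_pi) (auto simp: s_def)
  then have "cos (Im (d / 2)) > 0" by (intro cos_gt_zero_pi) auto
  then have "Re (exp (d / 2)) > 0" by (simp add: Re_exp)
  moreover have "(exp (d / 2))\<^sup>2 = y / (y - 1)"
  proof -
    have "(exp (d / 2))\<^sup>2 = exp d" by (simp add: exp_double[symmetric])
    also have "\<dots> = s\<^sup>2 / ((s + 1) * (s - 1))"
      using nz by (simp add: d_def exp_diff exp_add exp_double)
    also have "\<dots> = y / (y - 1)"
      by (simp add: s_def algebra_simps flip: power2_eq_square)
    finally show ?thesis .
  qed
  ultimately have "csqrt (y / (y - 1)) = exp (d / 2)" by (intro csqrt_unique) auto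
  then show ?thesis by (simp add: d_def s_def)
qed

text \<open>
  The correction \<open>d\<close> is the error of the trapezoidal rule for a logarithm of \<open>y - t\<^sup>2\<close>; stating
  the result with \<open>exp d\<close> avoids taking a logarithm of the product.
\<close>

lemma product_eq_pi_asymp_times_exp:
  fixes \<eta> :: real and n :: nat
  assumes \<eta>: "\<eta> > 0" and n: "n > 0"
    and y: "\<And>t. t \<in> {0..1} \<Longrightarrow> norm (y - of_real t) \<ge> \<eta>"
  shows "\<exists>d. norm d \<le> 1 / (n * (min 1 (\<eta> / 3))\<^sup>2) \<and>
     (\<Prod>k<n. (of_nat n)\<^sup>2 * y - (of_nat k)\<^sup>2) = pi_asymp n y * exp d"
proof -
  define s where "s = csqrt y"
  define \<delta> where "\<delta> = min 1 (\<eta> / 3)"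
  have \<delta>: "\<delta> > 0" using \<eta> by (simp add: \<delta>_def)
  have ynot: "y \<notin> closed_segment 0 1"
  proof
    assume "y \<in> closed_segment 0 1"
    then obtain t where "t \<in> {0..1}" "y = of_real t"
      by (auto simp: closed_segment_def scaleR_conv_of_real)
    with y[of t] \<eta> show False by simp
  qed
  note slit = csqrt_shift_not_nonpos_Reals[OF ynot, folded s_def]
  have ne: "s + z \<noteq> 0" "s - z \<noteq> 0" if "z \<in> closed_segment 0 1" for z
    using slit[OF that] by force+
  have away: "norm (s + z) \<ge> \<delta>" "norm (s - z) \<ge> \<delta>" if "z \<in> closed_segment 0 1" for z
    using csqrt_shift_norm_ge[OF y that] by (simp_all add: s_def \<delta>_def)
  \<comment> \<open>\<open>G\<close> is an antiderivative of \<open>g\<close>; the term \<open>- 2 z\<close> accounts for the factor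
    \<open>exp 1 ^ (- 2 n)\<close> in the asymptotic form.\<close>
  define G where "G z = (s + z) * Ln (s + z) - (s - z) * Ln (s - z) - 2 * z" for z
  define g where "g z = Ln (s + z) + Ln (s - z)" for z
  define g1 where "g1 z = 1 / (s + z) - 1 / (s - z)" for z
  define g2 where "g2 z = - (1 / (s + z)\<^sup>2 + 1 / (s - z)\<^sup>2)" for z
  define d where "d = (\<Sum>k<n. g (of_nat k / of_nat n)) - (of_nat n * (G 1 - G 0) + (g 0 - g 1) / 2)"
  have "norm d \<le> (2 / \<delta>\<^sup>2) / (2 * n)"
    unfolding d_def
  proof (rule riemann_sum_with_boundary_term[where g' = g1 and g'' = g2])
    fix z :: complex assume z: "z \<in> closed_segment 0 1"
    have [simp]: "s + z \<noteq> 0" "s \<noteq> z" using ne[OF z] by auto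
    note [simp] = slit[OF z]
    show "(G has_field_derivative g z) (at z)"
      unfolding G_def g_def by (auto intro!: derivative_eq_intros)
    show "(g has_field_derivative g1 z) (at z)"
      unfolding g_def g1_def by (auto intro!: derivative_eq_intros simp: field_simps)
    show "(g1 has_field_derivative g2 z) (at z)"
      unfolding g1_def g2_def
      by (auto intro!: derivative_eq_intros simp: power2_eq_square field_simps)
    have "norm (1 / (s + z)\<^sup>2) \<le> 1 / \<delta>\<^sup>2" "norm (1 / (s - z)\<^sup>2) \<le> 1 / \<delta>\<^sup>2"
      using away[OF z] \<delta> by (auto simp: norm_divide norm_power intro!: divide_left_mono power_mono)
    then show "norm (g2 z) \<le> 2 / \<delta>\<^sup>2"
      unfolding g2_def norm_minus_cancel by (intro order.trans[OF norm_triangle_ineq]) simp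
  qed (use n in auto)
  then have bound: "norm d \<le> 1 / (n * \<delta>\<^sup>2)" using \<delta> by (simp add: field_simps)
  have mem: "of_nat k / of_nat n \<in> closed_segment (0::complex) 1" if "k < n" for k
    unfolding closed_segment_def using that n
    by (auto intro!: exI[of _ "real k / real n"] simp: scaleR_conv_of_real)
  have n0: "(of_nat n :: complex) \<noteq> 0" using n by simp
  have factor: "(of_nat n)\<^sup>2 * y - (of_nat k)\<^sup>2 = (of_nat n)\<^sup>2 * exp (g (of_nat k / of_nat n))"
    if "k < n" for k
  proof -
    let ?z = "of_nat k / of_nat n :: complex"
    have "exp (g ?z) = (s + ?z) * (s - ?z)"
      using ne[OF mem[OF that]] by (simp add: g_def exp_add)
    also have "\<dots> = y - ?z\<^sup>2" by (simp add: s_def algebra_simps flip: power2_eq_square)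
    finally show ?thesis using n0 by (simp add: field_simps)
  qed
  have "(\<Prod>k<n. (of_nat n)\<^sup>2 * y - (of_nat k)\<^sup>2)
      = (\<Prod>k<n. (of_nat n)\<^sup>2 * exp (g (of_nat k / of_nat n)))"
    by (rule prod.cong) (auto simp: factor)
  also have "\<dots> = of_nat n ^ (2 * n) * exp (\<Sum>k<n. g (of_nat k / of_nat n))"
    by (simp add: prod.distrib exp_sum power_mult)
  also have "(\<Sum>k<n. g (of_nat k / of_nat n)) = of_nat n * (G 1 - G 0) + (g 0 - g 1) / 2 + d"
    by (simp add: d_def)
  also have "of_nat n * (G 1 - G 0) = of_nat n * ((s + 1) * Ln (s + 1) - (s - 1) * Ln (s - 1)) - of_nat (2 * n)"
    by (simp add: G_def algebra_simps)
  also have "(g 0 - g 1) / 2 = (2 * Ln s - (Ln (s + 1) + Ln (s - 1))) / 2"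
    by (simp add: g_def)
  also have "of_nat n ^ (2 * n) * exp (of_nat n * ((s + 1) * Ln (s + 1) - (s - 1) * Ln (s - 1))
      - of_nat (2 * n) + (2 * Ln s - (Ln (s + 1) + Ln (s - 1))) / 2 + d) = pi_asymp n y * exp d"
  proof -
    have "exp (of_nat (2 * n) :: complex) = exp 1 ^ (2 * n)"
      using exp_of_nat_mult[of "2 * n" "1::complex"] by simp
    then show ?thesis
      unfolding pi_asymp_def csqrt_eq_exp_boundary_term[OF ynot] s_def[symmetric]
      by (simp add: exp_add exp_diff power_divide)
  qed
  finally show ?thesis using bound by (auto simp: \<delta>_def)
qed

section \<open>The recurrence as a perturbed product\<close>

text \<open>
  With \<open>r\<^sub>m\<close> the ratio of \<open>\<pi>\<^sub>m\<close> to the product of the first \<open>m\<close> factors, the recurrence becomes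
  \<open>r\<^sub>m\<^sub>+\<^sub>2 = r\<^sub>m\<^sub>+\<^sub>1 - r\<^sub>m / (4 (x - m\<^sup>2) (x - (m+1)\<^sup>2))\<close>. Its perturbation is at most
  \<open>\<epsilon> = 1 / (4 c\<^sup>2)\<close> times \<open>r\<^sub>m\<close>, so \<open>r\<close> departs from \<open>1\<close> no faster than \<open>(1 + \<epsilon>)\<^sup>m\<close> does.
\<close>

lemma pi_poly_near_product:
  fixes x :: complex and c :: real
  assumes c: "c > 0" and x: "\<And>k. k < n \<Longrightarrow> norm (x - (of_nat k)\<^sup>2) \<ge> c"
  shows "\<exists>r. norm (r - 1) \<le> exp (n / (4 * c\<^sup>2)) - 1 \<and>
     poly (pi_poly n) x = r * (\<Prod>k<n. x - (of_nat k)\<^sup>2)"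
proof -
  define \<epsilon> where "\<epsilon> = 1 / (4 * c\<^sup>2)"
  have \<epsilon>: "\<epsilon> > 0" using c by (simp add: \<epsilon>_def)
  define P where "P m = (\<Prod>k<m. x - (of_nat k)\<^sup>2)" for m
  define r where "r m = poly (pi_poly m) x / P m" for m
  have nz: "x - (of_nat k)\<^sup>2 \<noteq> 0" if "k < n" for k
    using x[OF that] c by auto
  have P0: "P m \<noteq> 0" if "m \<le> n" for m
    using that nz by (auto simp: P_def)
  have rec: "norm (r (Suc (Suc m)) - r (Suc m)) \<le> \<epsilon> * norm (r m)" if "Suc (Suc m) \<le> n" for m
  proof -
    let ?a = "x - (of_nat m)\<^sup>2" and ?b = "x - (of_nat (Suc m))\<^sup>2"
    have ab: "norm ?a \<ge> c" "norm ?b \<ge> c" "?a \<noteq> 0" "?b \<noteq> 0"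
      using that by (intro x nz; simp)+
    have P: "P (Suc m) = P m * ?a" "P (Suc (Suc m)) = P m * ?a * ?b" "P m \<noteq> 0"
      using that by (simp_all add: P_def[of "Suc m"] P_def[of "Suc (Suc m)"] P_def[of m, symmetric] P0)
    have "poly (pi_poly (Suc (Suc m))) x = ?b * poly (pi_poly (Suc m)) x - poly (pi_poly m) x / 4"
      by (simp add: algebra_simps)
    then have "r (Suc (Suc m)) - r (Suc m) = - (1 / (4 * (?a * ?b)) * r m)"
      using ab(3,4) P(3) unfolding r_def P(1,2)
      by (simp del: pi_poly.simps of_nat_Suc add: divide_simps)
    then have "norm (r (Suc (Suc m)) - r (Suc m)) = 1 / (4 * (norm ?a * norm ?b)) * norm (r m)"
      by (simp only: norm_minus_cancel norm_mult norm_divide norm_one norm_numeral)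
    also have "\<dots> \<le> \<epsilon> * norm (r m)"
      using ab(1,2) c unfolding \<epsilon>_def power2_eq_square
      by (intro mult_right_mono divide_left_mono mult_left_mono mult_mono mult_pos_pos) auto
    finally show ?thesis .
  qed
  have main: "norm (r m - 1) \<le> (1 + \<epsilon>) ^ m - 1" if "m \<le> n" for m
    using that
  proof (induction m rule: pi_poly.induct)
    case 1
    then show ?case by (simp add: r_def P_def)
  next
    case 2
    then have "x \<noteq> 0" using nz[of 0] by simp
    then show ?case using \<epsilon> by (simp add: r_def P_def)
  next
    case (3 m)
    have "norm (r m) \<le> (1 + \<epsilon>) ^ m"
      using norm_triangle_ineq[of "r m - 1" 1] 3 by simp
    also have "\<dots> \<le> (1 + \<epsilon>) ^ Suc m" using \<epsilon> by (intro power_increasing) auto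
    finally have "norm (r (Suc (Suc m)) - r (Suc m)) \<le> \<epsilon> * (1 + \<epsilon>) ^ Suc m"
      using rec[of m] 3(3) \<epsilon> by (meson mult_left_mono order.trans less_imp_le)
    moreover have "norm (r (Suc m) - 1) \<le> (1 + \<epsilon>) ^ Suc m - 1" using 3 by simp
    ultimately have "norm (r (Suc (Suc m)) - 1) \<le> \<epsilon> * (1 + \<epsilon>) ^ Suc m + ((1 + \<epsilon>) ^ Suc m - 1)"
      using norm_triangle_ineq[of "r (Suc (Suc m)) - r (Suc m)" "r (Suc m) - 1"] by simp
    then show ?case by (simp add: algebra_simps)
  qed
  have "poly (pi_poly n) x = r n * P n" using P0[of n] by (simp add: r_def)
  moreover have "(1 + \<epsilon>) ^ n \<le> exp \<epsilon> ^ n"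
    using \<epsilon> by (intro power_mono exp_ge_add_one_self) auto
  then have "(1 + \<epsilon>) ^ n \<le> exp (n / (4 * c\<^sup>2))"
    by (simp add: exp_of_nat_mult[symmetric] \<epsilon>_def)
  then have "norm (r n - 1) \<le> exp (n / (4 * c\<^sup>2)) - 1"
    using main[of n] by simp
  ultimately show ?thesis by (auto simp: P_def)
qed

section \<open>The uniform asymptotic formula\<close>

theorem theorem4p1:
  fixes \<eta> :: real
  assumes "\<eta> > 0"
  shows "uniform_limit {y :: complex. infdist y (closed_segment 0 1) \<ge> \<eta>}
           (\<lambda>n y. poly (pi_poly n) ((of_nat n)\<^sup>2 * y) / pi_asymp n y)
           (\<lambda>y. 1) sequentially"
proof -
  \<comment> \<open>\<open>K / n\<close> bounds the error of the trapezoidal rule, and the first summand of \<open>B n\<close> below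
    bounds the error of the perturbed product; neither depends on \<open>y\<close>.\<close>
  define K where "K = 1 / (min 1 (\<eta> / 3))\<^sup>2"
  define B where "B n = (exp (n / (4 * ((real n)\<^sup>2 * \<eta>)\<^sup>2)) - 1 + K / n) * exp (K / n)" for n
  have bound: "norm (poly (pi_poly n) ((of_nat n)\<^sup>2 * y) / pi_asymp n y - 1) \<le> B n"
    if n: "n > 0" and y: "infdist y (closed_segment 0 1) \<ge> \<eta>" for n :: nat and y :: complex
  proof -
    have far: "norm (y - of_real t) \<ge> \<eta>" if "t \<in> {0..1}" for t
    proof -
      have "of_real t \<in> closed_segment (0::complex) 1"
        using that by (auto simp: closed_segment_def scaleR_conv_of_real)
      from infdist_le[OF this, of y] y show ?thesis by (simp add: dist_norm)
    qed
    obtain d where d: "norm d \<le> 1 / (n * (min 1 (\<eta> / 3))\<^sup>2)"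
      "(\<Prod>k<n. (of_nat n)\<^sup>2 * y - (of_nat k)\<^sup>2) = pi_asymp n y * exp d"
      using product_eq_pi_asymp_times_exp[OF assms n far] by blast
    have xk: "norm ((of_nat n)\<^sup>2 * y - (of_nat k)\<^sup>2) \<ge> (real n)\<^sup>2 * \<eta>" if "k < n" for k
    proof -
      have "(of_nat n)\<^sup>2 * y - (of_nat k)\<^sup>2 = (of_nat n)\<^sup>2 * (y - of_real ((real k / real n)\<^sup>2))"
        using n by (simp add: field_simps)
      moreover have "norm (y - of_real ((real k / real n)\<^sup>2)) \<ge> \<eta>"
        using that by (intro far) (auto simp: power_le_one)
      ultimately show ?thesis
        by (simp add: norm_mult norm_power mult_left_mono del: of_real_power of_real_divide)
    qed
    obtain r where r: "norm (r - 1) \<le> exp (n / (4 * ((real n)\<^sup>2 * \<eta>)\<^sup>2)) - 1"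
      "poly (pi_poly n) ((of_nat n)\<^sup>2 * y) = r * (\<Prod>k<n. (of_nat n)\<^sup>2 * y - (of_nat k)\<^sup>2)"
      using pi_poly_near_product[OF _ xk] n assms by auto
    have "(\<Prod>k<n. (of_nat n)\<^sup>2 * y - (of_nat k)\<^sup>2) \<noteq> 0"
    proof -
      have "0 < (real n)\<^sup>2 * \<eta>" using n assms by simp
      then show ?thesis using xk by (force simp: prod_zero_iff)
    qed
    then have "pi_asymp n y \<noteq> 0" using d(2) by auto
    then have "poly (pi_poly n) ((of_nat n)\<^sup>2 * y) / pi_asymp n y - 1 = (r - 1) * exp d + (exp d - 1)"
      using r(2) d(2) by (simp add: field_simps)
    also have "norm \<dots> \<le> norm (r - 1) * exp (norm d) + exp (norm d) * norm d"
    proof (intro order.trans[OF norm_triangle_ineq] add_mono)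
      show "norm ((r - 1) * exp d) \<le> norm (r - 1) * exp (norm d)"
        by (auto simp: norm_mult complex_Re_le_cmod intro!: mult_left_mono)
      have "norm (exp d - 1) \<le> exp \<bar>Re d\<bar> * norm d"
        using Taylor_exp[of d 0] by simp
      also have "\<dots> \<le> exp (norm d) * norm d"
        by (intro mult_right_mono) (auto simp: abs_Re_le_cmod)
      finally show "norm (exp d - 1) \<le> exp (norm d) * norm d" .
    qed
    also have "\<dots> = (norm (r - 1) + norm d) * exp (norm d)" by (simp add: algebra_simps)
    also have "\<dots> \<le> B n"
    proof -
      have "norm d \<le> K / n" using d(1) by (simp add: K_def mult.commute)
      with r(1) show ?thesis
        unfolding B_def
        by (intro mult_mono add_mono) (auto intro: add_nonneg_nonneg order.trans[OF norm_ge_zero])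
    qed
    finally show ?thesis .
  qed
  have B: "B \<longlonglongrightarrow> 0"
  proof -
    have K: "(\<lambda>n. K / real n) \<longlonglongrightarrow> 0" by (rule lim_const_over_n)
    have "(\<lambda>n. 1 / (4 * \<eta>\<^sup>2) * (1 / real n) ^ 3) \<longlonglongrightarrow> 1 / (4 * \<eta>\<^sup>2) * 0 ^ 3"
      by (intro tendsto_intros lim_const_over_n)
    moreover have "real n / (4 * ((real n)\<^sup>2 * \<eta>)\<^sup>2) = 1 / (4 * \<eta>\<^sup>2) * (1 / real n) ^ 3" for n
      by (cases "n = 0") (simp_all add: power2_eq_square power3_eq_cube)
    ultimately have "(\<lambda>n. real n / (4 * ((real n)\<^sup>2 * \<eta>)\<^sup>2)) \<longlonglongrightarrow> 0" by simp
    then have "B \<longlonglongrightarrow> (exp 0 - 1 + 0) * exp 0"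
      unfolding B_def by (intro tendsto_intros K)
    then show ?thesis by simp
  qed
  show ?thesis
  proof (rule uniform_limitI)
    fix e :: real assume "e > 0"
    with B have "eventually (\<lambda>n. B n < e) sequentially"
      by (simp add: order_tendstoD(2))
    then show "\<forall>\<^sub>F n in sequentially. \<forall>y\<in>{y. infdist y (closed_segment 0 1) \<ge> \<eta>}.
        dist (poly (pi_poly n) ((of_nat n)\<^sup>2 * y) / pi_asymp n y) 1 < e"
      using eventually_gt_at_top[of 0]
    proof eventually_elim
      case (elim n)
      then show ?case using bound[OF elim(2)] by (auto simp: dist_norm intro: le_less_trans)
    qed
  qed
qed

end
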